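(* Let $T$ denote the set of nonnegative integers for which the sum of any two consecutive digits in the base-$3$ expansion is always less than $3$. Let $T'=\{t\in T : t\not\equiv 2 \pmod 3\}$. Then for every integer $n\ge 1$, one has $e_3(n-1,n)=s_3(n)$ if and only if $$n\in (3T+1)\cup(3T'+2)\cup(9T+3).$$
   Context: For integers $a,b$ and a set $A$ of integers, $aA+b=\{at+b : t\in A\}$. $\nu_3(m)$ denotes the exponent of $3$ in the integer $m$, with $\nu_3(0)=\infty$; $[x]$ is the integer part of $x$. For integers $k\ge 0$ and $j\ge 0$ define the partial Stirling number $a_3(k,j)=\sum_{i\not\equiv 0\ (\mathrm{mod}\ 3)}(-1)^i\binom{j}{i}i^k$. For $k\ge 0$, $n\ge 1$ define $e_3(k,n)=\min\{\nu_3(a_3(k,j)) : j\ge n\}$. Define $s_3(n)=n-1+\nu_3([n/3]!)$. Integers with a one-digit base-$3$ expansion satisfy the digit condition vacuously. *)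

theory Defs
  imports Main "HOL-Library.Extended_Nat" "HOL-Computational_Algebra.Primes"
begin

text \<open>The exponent of 3 in an integer, with value \<open>\<infinity>\<close> at 0. (The library's
  \<^const>\<open>multiplicity\<close> is 0 there.)\<close>

definition nu3 :: "int \<Rightarrow> enat" where
  "nu3 m = (if m = 0 then \<infinity> else enat (multiplicity 3 m))"

text \<open>The sum is cut off at \<open>j\<close>, since the binomial coefficient vanishes for \<open>i > j\<close>.\<close>

definition a3 :: "nat \<Rightarrow> nat \<Rightarrow> int" where
  "a3 k j = (\<Sum>i | i \<le> j \<and> \<not> 3 dvd i. (- 1) ^ i * int (j choose i) * int i ^ k)"

text \<open>The infimum is over a nonempty set of extended naturals, so it is attained.\<close>

definition e3 :: "nat \<Rightarrow> nat \<Rightarrow> enat" where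
  "e3 k n = (INF j\<in>{n..}. nu3 (a3 k j))"

definition s3 :: "nat \<Rightarrow> nat" where
  "s3 n = n - 1 + multiplicity 3 (fact (n div 3) :: nat)"

definition digit3 :: "nat \<Rightarrow> nat \<Rightarrow> nat" where
  "digit3 t i = t div 3 ^ i mod 3"

text \<open>The guard \<open>3 ^ Suc i \<le> t\<close> says that position \<open>Suc i\<close>, and hence also position \<open>i\<close>,
  occurs in the base-3 expansion of \<open>t\<close>.\<close>

definition T :: "nat set" where
  "T = {t. \<forall>i. 3 ^ Suc i \<le> t \<longrightarrow> digit3 t i + digit3 t (Suc i) < 3}"

definition T' :: "nat set" where
  "T' = {t \<in> T. t mod 3 \<noteq> 2}"

end

theory Submission
  imports Defs "HOL-Number_Theory.Cong" "HOL-Combinatorics.Stirling"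
begin

text \<open>
  For \<open>k < j\<close> the full alternating sum \<open>\<Sum>i\<le>j. (-1)^i (j choose i) i^k\<close> vanishes, so \<open>a3 k j\<close> equals
  \<open>-3^k W\<close> with \<open>W = \<Sum>i. (-1)^i (j choose 3i) i^k\<close>. Writing \<open>m = j div 3\<close>, the absorption identity
  for binomial coefficients shows inductively that \<open>W\<close> is congruent to \<open>(-1)^m m! S(k,m)\<close> modulo
  \<open>3\<close> times the 3-part of \<open>m!\<close>, where \<open>S\<close> denotes Stirling numbers of the second kind. Hence
  \<open>e3 (n - 1) n = s3 n\<close> iff some \<open>S(n - 1, m)\<close> with \<open>m \<ge> n div 3\<close> and \<open>m div 3 = n div 9\<close> is prime
  to 3. Modulo 3 the generating function of \<open>S(-, 3q + s)\<close> is \<open>x^(3q+s)\<close> divided by \<open>(1 - x^2)^q\<close>,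
  \<open>(1 - x)(1 - x^2)^q\<close> or \<open>(1 - x^2)^(q+1)\<close>, so that these numbers vanish or are binomial coefficients
  \<open>q + l choose l\<close>; in the cases that matter \<open>q = t div 3\<close> and \<open>l = t\<close>, and by Lucas' theorem
  \<open>t + t div 3 choose t\<close> is prime to 3 iff adding \<open>t\<close> and \<open>t div 3\<close> in base 3 produces no carry,
  that is, iff \<open>t \<in> T\<close>.
\<close>

section \<open>A binomial recurrence for Stirling numbers\<close>

text \<open>Combinatorially, \<open>l\<close> counts the elements outside the block of a
  distinguished one. The same binomial sum appears in \<open>trisum_mod\<close>, where an index
  shift is expanded.\<close>

lemma Stirling_Suc_Suc_eq_sum:
  "Stirling (Suc k) (Suc m) = (\<Sum>l\<le>k. (k choose l) * Stirling l m)"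
proof (induction k arbitrary: m)
  case 0
  show ?case by (cases m) auto
next
  case (Suc k)
  have "(\<Sum>l\<le>Suc k. (Suc k choose l) * Stirling l m)
      = Stirling 0 m + (\<Sum>l\<le>k. (k choose Suc l) * Stirling (Suc l) m)
        + (\<Sum>l\<le>k. (k choose l) * Stirling (Suc l) m)"
    by (simp add: sum.atMost_Suc_shift sum.distrib algebra_simps del: sum.atMost_Suc)
  also have "Stirling 0 m + (\<Sum>l\<le>k. (k choose Suc l) * Stirling (Suc l) m)
      = (\<Sum>l\<le>Suc k. (k choose l) * Stirling l m)"
    by (simp add: sum.atMost_Suc_shift del: sum.atMost_Suc)
  also have "\<dots> = Stirling (Suc k) (Suc m)"
    using Suc by simp
  finally have rec: "(\<Sum>l\<le>Suc k. (Suc k choose l) * Stirling l m)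
      = Stirling (Suc k) (Suc m) + (\<Sum>l\<le>k. (k choose l) * Stirling (Suc l) m)" .
  show ?case
  proof (cases m)
    case 0
    then show ?thesis using rec by simp
  next
    case (Suc m')
    have "(\<Sum>l\<le>k. (k choose l) * Stirling (Suc l) m)
        = m * (\<Sum>l\<le>k. (k choose l) * Stirling l m) + (\<Sum>l\<le>k. (k choose l) * Stirling l m')"
      by (simp add: Suc sum.distrib sum_distrib_left algebra_simps)
    also have "\<dots> = m * Stirling (Suc k) (Suc m) + Stirling (Suc k) (Suc m')"
      by (simp only: Suc.IH)
    finally show ?thesis
      using rec Suc by (simp add: Suc.IH[symmetric])
  qed
qed

subsection \<open>Alternating sums over every third binomial coefficient\<close>

text \<open>The power is of \<open>i\<close> and not of \<open>3 * i + r\<close>, so for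
  \<open>r = 0\<close> the factor \<open>3 ^ k\<close> is already taken out. The sign is that of
  \<open>3 * i\<close>. Terms with \<open>3 * i + r > n\<close> vanish, so the upper bound is
  generous.\<close>

definition trisum :: "nat \<Rightarrow> nat \<Rightarrow> nat \<Rightarrow> int" where
  "trisum n r k = (\<Sum>i\<le>n. (- 1) ^ i * int (n choose (3 * i + r)) * int i ^ k)"

lemma trisum_extend:
  assumes "n \<le> N"
  shows "trisum n r k = (\<Sum>i\<le>N. (- 1) ^ i * int (n choose (3 * i + r)) * int i ^ k)"
  unfolding trisum_def using assms by (intro sum.mono_neutral_left) auto

lemma trisum_shift:
  "(\<Sum>i\<le>n. (- 1) ^ i * int (n choose (3 * i + r)) * int (Suc i) ^ k)
     = (\<Sum>l\<le>k. int (k choose l) * trisum n r l)"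
proof -
  have *: "int (Suc i) ^ k = (\<Sum>l\<le>k. int (k choose l) * int i ^ l)" for i
    using binomial_ring[of "int i" 1 k] by (simp add: add.commute)
  show ?thesis
    unfolding * trisum_def sum_distrib_left
    by (subst sum.swap) (simp add: algebra_simps)
qed

lemma trisum_Suc_Suc: "trisum (Suc n) (Suc r) k = trisum n (Suc r) k + trisum n r k"
  unfolding trisum_extend[of n "Suc n", OF le_SucI[OF le_refl]]
  by (simp add: trisum_def sum.distrib algebra_simps del: sum.atMost_Suc)

text \<open>Pascal's rule with wrap-around: the predecessor of \<open>3 * Suc i\<close> is
  \<open>3 * i + 2\<close>, so the shift of \<open>i\<close> flips the sign and expands the power
  binomially.\<close>

lemma trisum_Suc_0:
  "trisum (Suc n) 0 k = trisum n 0 k - (\<Sum>l\<le>k. int (k choose l) * trisum n 2 l)"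
  unfolding trisum_extend[of n "Suc n", OF le_SucI[OF le_refl], where r = 0]
    trisum_shift[symmetric]
  by (simp add: trisum_def sum.atMost_Suc_shift sum.distrib sum_negf sum_subtractf algebra_simps
      numeral_2_eq_2 numeral_3_eq_3 del: sum.atMost_Suc)

text \<open>Absorption produces the factor \<open>3 * i + Suc r\<close>; its part
  \<open>3 * i\<close> raises the exponent and brings the factor 3 that drives the inner induction
  of \<open>trisum_mod\<close>.\<close>

lemma trisum_absorb:
  "int (Suc r) * trisum (Suc n) (Suc r) k + 3 * trisum (Suc n) (Suc r) (Suc k)
     = int (Suc n) * trisum n r k"
proof -
  have "int (3 * i + Suc r) * int (Suc n choose (3 * i + Suc r))
    = int (Suc n) * int (n choose (3 * i + r))" for i
    using arg_cong[OF Suc_times_binomial[of "3 * i + r" n], of int]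
    by (simp only: of_nat_mult add_Suc_right)
  then have "(int (3 * i + Suc r) * int (Suc n choose (3 * i + Suc r))) * ((- 1) ^ i * int i ^ k)
      = (int (Suc n) * int (n choose (3 * i + r))) * ((- 1) ^ i * int i ^ k)" for i
    by (rule arg_cong)
  then have *: "int (Suc r) * ((- 1) ^ i * int (Suc n choose (3 * i + Suc r)) * int i ^ k)
        + 3 * ((- 1) ^ i * int (Suc n choose (3 * i + Suc r)) * int i ^ Suc k)
      = int (Suc n) * ((- 1) ^ i * int (n choose (3 * i + r)) * int i ^ k)" for i
    by (simp only: of_nat_add of_nat_mult of_nat_numeral distrib_right distrib_left power_Suc ac_simps)
  show ?thesis
    unfolding trisum_extend[of n "Suc n", OF le_SucI[OF le_refl]]
    unfolding trisum_def sum_distrib_left sum.distrib[symmetric] * ..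
qed

text \<open>For residue 0 the absorbed factor is a bare \<open>3 * i\<close>, so only one sum
  remains on the left. The term at \<open>i = 0\<close> vanishes because the exponent is
  positive.\<close>

lemma trisum_absorb_0:
  "3 * trisum (Suc n) 0 (Suc k) = - int (Suc n) * (\<Sum>l\<le>k. int (k choose l) * trisum n 2 l)"
proof -
  have *: "3 * ((- 1) ^ Suc i * int (Suc n choose (3 * Suc i)) * int (Suc i) ^ Suc k)
      = - int (Suc n) * ((- 1) ^ i * int (n choose (3 * i + 2)) * int (Suc i) ^ k)" for i
  proof -
    have "int (3 * Suc i) * int (Suc n choose (3 * Suc i))
      = int (Suc n) * int (n choose (3 * i + 2))"
      using arg_cong[OF Suc_times_binomial[of "3 * i + 2" n], of int]
      by (simp only: of_nat_mult) (simp add: numeral_2_eq_2 numeral_3_eq_3)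
    then have "3 * int (Suc i) * int (Suc n choose (3 * Suc i))
      = int (Suc n) * int (n choose (3 * i + 2))"
      by (simp only: of_nat_mult of_nat_numeral)
    then have "(3 * int (Suc i) * int (Suc n choose (3 * Suc i))) * ((- 1) ^ Suc i * int (Suc i) ^ k)
       = (int (Suc n) * int (n choose (3 * i + 2))) * ((- 1) ^ Suc i * int (Suc i) ^ k)"
      by (rule arg_cong)
    then show ?thesis
      by (simp only: power_Suc ac_simps)
  qed
  have "3 * trisum (Suc n) 0 (Suc k)
      = (\<Sum>i\<le>n. 3 * ((- 1) ^ Suc i * int (Suc n choose (3 * Suc i)) * int (Suc i) ^ Suc k))"
    unfolding trisum_def sum.atMost_Suc_shift add_0_right by (simp add: sum_distrib_left)
  also have "\<dots> = - int (Suc n) * (\<Sum>l\<le>k. int (k choose l) * trisum n 2 l)"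
    unfolding * sum_distrib_left[symmetric] trisum_shift ..
  finally show ?thesis .
qed

section \<open>Partial Stirling numbers as sums over multiples of 3\<close>

text \<open>Up to sign this is the \<open>j\<close>-th finite difference of a polynomial of degree
  \<open>k < j\<close>. Absorption lowers \<open>j\<close> by one and leaves only smaller
  exponents.\<close>

lemma alternating_binomial_power_sum:
  assumes "k < j"
  shows "(\<Sum>i\<le>j. (- 1) ^ i * int (j choose i) * int i ^ k) = 0"
  using assms
proof (induction k arbitrary: j rule: less_induct)
  case (less k)
  then obtain j' where j: "j = Suc j'" by (cases j) auto
  show ?case
  proof (cases k)
    case 0
    then show ?thesis using choose_alternating_sum[of j, where 'a = int] less.prems by simp
  next
    case (Suc k')
    have *: "(- 1) ^ Suc i * int (j choose Suc i) * int (Suc i) ^ k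
       = - int j * (\<Sum>l\<le>k'. int (k' choose l) * ((- 1) ^ i * int (j' choose i) * int i ^ l))" for i
    proof -
      have "int (Suc i) ^ k' = (\<Sum>l\<le>k'. int (k' choose l) * int i ^ l)"
        using binomial_ring[of "int i" 1 k'] by (simp add: add.commute)
      moreover have "int (Suc i) * int (j choose Suc i) = int j * int (j' choose i)"
        unfolding j using arg_cong[OF Suc_times_binomial[of i j'], of int]
          by (simp only: of_nat_mult)
      then have "(- 1) ^ Suc i * int (j choose Suc i) * int (Suc i) ^ k
          = - int j * ((- 1) ^ i * int (j' choose i) * int (Suc i) ^ k')"
        by (simp add: Suc mult.commute)
      ultimately show ?thesis
        by (simp add: sum_distrib_left algebra_simps)
    qed
    have "(\<Sum>i\<le>j. (- 1) ^ i * int (j choose i) * int i ^ k)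
        = (\<Sum>i\<le>j'. (- 1) ^ Suc i * int (j choose Suc i) * int (Suc i) ^ k)"
      unfolding j sum.atMost_Suc_shift using Suc by simp
    also have "\<dots> = - int j * (\<Sum>l\<le>k'. int (k' choose l) * (\<Sum>i\<le>j'. (- 1) ^ i * int (j' choose i) * int i ^ l))"
      unfolding * sum_distrib_left[symmetric]
      by (subst sum.swap) (simp add: sum_distrib_left)
    also have "\<dots> = 0"
      using less Suc j by (simp add: less.IH)
    finally show ?thesis .
  qed
qed

lemma sum_split_mod_3:
  fixes f :: "nat \<Rightarrow> 'a::comm_monoid_add"
  shows "(\<Sum>i<3*n. f i) = (\<Sum>i<n. f (3 * i)) + (\<Sum>i<n. f (3 * i + 1)) + (\<Sum>i<n. f (3 * i + 2))"
  by (induction n) (simp_all add: eval_nat_numeral add_ac)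

lemma a3_eq_trisum:
  assumes "k < j"
  shows "a3 k j = - (3 ^ k) * trisum j 0 k"
proof -
  let ?f = "\<lambda>i. (- 1) ^ i * int (j choose i) * int i ^ k"
  have "sum ?f {..j} = sum ?f {i. i \<le> j \<and> \<not> 3 dvd i} + sum ?f {i. i \<le> j \<and> 3 dvd i}"
    by (subst sum.union_disjoint[symmetric]) (auto intro!: sum.cong)
  then have "a3 k j = - sum ?f {i. i \<le> j \<and> 3 dvd i}"
    using alternating_binomial_power_sum[OF assms] by (simp add: a3_def)
  \<comment> \<open>The image reaches up to \<open>3 * j\<close>; the added binomial coefficients
    vanish.\<close>
  also have "sum ?f {i. i \<le> j \<and> 3 dvd i} = sum ?f ((*) 3 ` {..j})"
    by (intro sum.mono_neutral_left) (auto elim!: dvdE)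
  also have "\<dots> = 3 ^ k * trisum j 0 k"
    by (subst sum.reindex)
       (auto simp: inj_on_def trisum_def sum_distrib_left power_mult_distrib power_mult intro!: sum.cong)
  finally show ?thesis by simp
qed

text \<open>This settles exponent 0 at residue 0, which \<open>trisum_absorb_0\<close> does not
  reach.\<close>

lemma trisum_alternating:
  assumes "n > 0"
  shows "trisum n 0 0 - trisum n 1 0 + trisum n 2 0 = 0"
proof -
  let ?f = "\<lambda>i. (- 1) ^ i * int (n choose i)"
  \<comment> \<open>Padding with zero terms lets every residue class run over all \<open>i\<close>
    up to \<open>n\<close>.\<close>
  have "(\<Sum>i<3 * Suc n. ?f i) = (\<Sum>i\<le>n. ?f i)"
    by (intro sum.mono_neutral_right) auto
  also have "\<dots> = 0"
    using choose_alternating_sum[OF assms, where 'a = int] by simp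
  finally show ?thesis
    unfolding sum_split_mod_3
    by (simp add: trisum_def lessThan_Suc_atMost power_add power_mult sum_negf del: sum.lessThan_Suc sum.atMost_Suc)
qed


section \<open>Trisected sums modulo powers of 3\<close>

text \<open>Modulo \<open>D\<close>, two Pascal steps take the sums at residues 0, 1, 2 from
  \<open>(x, 0, 0)\<close> via \<open>(x, x, 0)\<close> to \<open>(x, 2 x, x)\<close>: residue 0 is
  altered only by residue-2 sums of the preceding row.\<close>

lemma trisum_add_mod:
  assumes "\<And>l. D dvd trisum n 1 l" "\<And>l. D dvd trisum n 2 l"
  shows "s < 3 \<Longrightarrow> [trisum (n + s) 0 k = trisum n 0 k] (mod D)"
    and "[trisum (n + 2) 1 k = 2 * trisum n 0 k] (mod D)"
    and "[trisum (n + 2) 2 k = trisum n 0 k] (mod D)"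
proof -
  have rec: "trisum (Suc m) 1 l = trisum m 1 l + trisum m 0 l"
    "trisum (Suc m) 2 l = trisum m 2 l + trisum m 1 l" for m l
    using trisum_Suc_Suc[of m 0 l] trisum_Suc_Suc[of m 1 l] by (simp_all add: numeral_2_eq_2)
  have 0: "D dvd trisum n 0 l - trisum (Suc n) 0 l" for l
    unfolding trisum_Suc_0 using assms by (auto intro!: dvd_sum)
  have "D dvd trisum (Suc n) 2 l" for l
    using assms by (simp only: rec dvd_add)
  then have 1: "D dvd trisum (Suc n) 0 l - trisum (Suc (Suc n)) 0 l" for l
    unfolding trisum_Suc_0[of "Suc n"] by (auto intro!: dvd_sum)
  have 2: "D dvd trisum n 0 l - trisum (Suc (Suc n)) 0 l" for l
    using dvd_add[OF 0[of l] 1[of l]] by simp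
  show "[trisum (n + s) 0 k = trisum n 0 k] (mod D)" if "s < 3"
  proof -
    have "s = 0 \<or> s = 1 \<or> s = 2" using that by linarith
    then show ?thesis
      using 0[of k] 2[of k] by (auto simp: cong_iff_dvd_diff dvd_diff_commute)
  qed
  have "D dvd trisum n 1 k - (trisum n 0 k - trisum (Suc n) 0 k)"
    "D dvd trisum n 2 k + 2 * trisum n 1 k"
    by (rule dvd_diff[OF assms(1) 0]) (rule dvd_add[OF assms(2) dvd_mult[OF assms(1)]])
  then show "[trisum (n + 2) 1 k = 2 * trisum n 0 k] (mod D)"
    and "[trisum (n + 2) 2 k = trisum n 0 k] (mod D)"
    unfolding cong_iff_dvd_diff add_2_eq_Suc' rec by (simp_all add: algebra_simps)
qed

lemma multiplicity_3_fact_Suc: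
  "multiplicity 3 (fact (Suc m) :: nat) = multiplicity 3 (Suc m) + multiplicity 3 (fact m :: nat)"
  by (simp add: prime_elem_multiplicity_mult_distrib del: mult_Suc)

lemma dvd_Suc_mult_fact_power:
  fixes x :: int
  assumes "3 ^ (a + multiplicity 3 (fact m :: nat)) dvd x"
  shows "3 ^ (a + multiplicity 3 (fact (Suc m) :: nat)) dvd int (Suc m) * x"
proof -
  have "int (3 ^ multiplicity 3 (Suc m)) dvd int (Suc m)"
    by (subst of_nat_dvd_iff) (rule multiplicity_dvd)
  then show ?thesis
    using mult_dvd_mono[of "3 ^ multiplicity 3 (Suc m)" "int (Suc m)", OF _ assms]
    by (simp add: multiplicity_3_fact_Suc power_add mult_ac del: fact_Suc)
qed

text \<open>Going from \<open>3 * m\<close> to \<open>3 * m + 2\<close> keeps the modulus, by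
  \<open>trisum_add_mod\<close>. The last step, to \<open>3 * Suc m\<close>, is absorption, whose
  factor \<open>3 * Suc m\<close> accounts for the larger modulus \<open>D (Suc m)\<close>.\<close>

lemma trisum_mod:
  defines "D \<equiv> \<lambda>m. 3 ^ (1 + multiplicity 3 (fact m :: nat)) :: int"
  shows "(\<forall>k. D m dvd trisum (3 * m) 1 k \<and> D m dvd trisum (3 * m) 2 k) \<and>
    (\<forall>k. [trisum (3 * m) 0 k = (- 1) ^ m * fact m * int (Stirling k m)] (mod D m))"
proof (induction m)
  case 0
  have "Stirling k 0 = 0 ^ k" for k by (cases k) auto
  then show ?case by (simp add: trisum_def)
next
  case (Suc m)
  let ?n = "3 * m + 2"
  let ?S = "\<lambda>l. (- 1) ^ m * fact m * int (Stirling l m)"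
  have n: "3 * Suc m = Suc ?n" by simp
  note IH = Suc.IH[THEN conjunct1, rule_format] Suc.IH[THEN conjunct2, rule_format]
  have n0: "[trisum ?n 0 l = ?S l] (mod D m)" for l
    using trisum_add_mod(1)[of "D m" "3 * m" 2 l] IH cong_trans by fastforce
  have n1: "[trisum ?n 1 l = 2 * ?S l] (mod D m)" for l
    using trisum_add_mod(2)[of "D m" "3 * m" l] IH cong_trans[OF _ cong_scalar_left] by blast
  have n2: "[trisum ?n 2 l = ?S l] (mod D m)" for l
    using trisum_add_mod(3)[of "D m" "3 * m" l] IH cong_trans by blast
  define v where "v = multiplicity 3 (fact m :: nat)"
  have "int (3 ^ v) dvd int (fact m)"
    unfolding v_def by (subst of_nat_dvd_iff) (rule multiplicity_dvd)
  then have "3 ^ v dvd ?S l" for l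
    by simp
  moreover have "3 ^ v dvd D m"
    by (simp add: D_def v_def)
  \<comment> \<open>One power of 3 less than \<open>D m\<close> is enough here, since
    \<open>Suc ?n = 3 * Suc m\<close> supplies the missing one.\<close>
  ultimately have n01: "3 ^ v dvd trisum ?n 0 l" "3 ^ v dvd trisum ?n 1 l" for l
    using n0[of l] n1[of l] by (meson cong_dvd_iff cong_dvd_modulus dvd_mult)+
  have reduce: "D (Suc m) dvd trisum (Suc ?n) (Suc r) k" if "r < 2" for r k
  proof -
    have rec: "D (Suc m) dvd int (Suc r) * trisum (Suc ?n) (Suc r) k
      + 3 * trisum (Suc ?n) (Suc r) (Suc k)" for k
    proof -
      have "r = 0 \<or> r = 1" using that by auto
      then have "3 ^ (0 + v) dvd trisum ?n r k"
        using n01 by auto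
      then have "3 ^ (0 + multiplicity 3 (fact (Suc m) :: nat)) dvd int (Suc m) * trisum ?n r k"
        unfolding v_def by (rule dvd_Suc_mult_fact_power)
      then have "D (Suc m) dvd int (Suc ?n) * trisum ?n r k"
        unfolding D_def n[symmetric] of_nat_mult mult.assoc power_add
          by (intro mult_dvd_mono) simp_all
      then show ?thesis
        by (simp only: trisum_absorb)
    qed
    have co: "coprime (3 ^ e) (int (Suc r))" for e
      using \<open>r < 2\<close> by (auto simp: less_2_cases_iff intro!: coprime_power_left_iff[THEN iffD2])
    text \<open>By \<open>rec\<close>, each step from exponent \<open>k\<close> to \<open>Suc k\<close> gains a factor 3.\<close>
    have "3 ^ e dvd D (Suc m) \<Longrightarrow> 3 ^ e dvd trisum (Suc ?n) (Suc r) k" for e k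
    proof (induction e arbitrary: k)
      case 0
      show ?case by simp
    next
      case (Suc e)
      have "3 ^ e dvd D (Suc m)"
        using Suc.prems by (meson dvd_trans le_imp_power_dvd le_SucI le_refl)
      then have "3 ^ Suc e dvd 3 * trisum (Suc ?n) (Suc r) (Suc k)"
        using Suc.IH by simp
      moreover have "3 ^ Suc e dvd int (Suc r) * trisum (Suc ?n) (Suc r) k
        + 3 * trisum (Suc ?n) (Suc r) (Suc k)"
        using Suc.prems rec dvd_trans by blast
      ultimately have "3 ^ Suc e dvd int (Suc r) * trisum (Suc ?n) (Suc r) k"
        by (simp only: dvd_add_left_iff)
      then show ?case
        using co coprime_dvd_mult_right_iff by blast
    qed
    then show ?thesis
      unfolding D_def using dvd_refl by blast
  qed
  have A: "D (Suc m) dvd trisum (Suc ?n) 1 k" "D (Suc m) dvd trisum (Suc ?n) 2 k" for k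
    using reduce[of 0] reduce[of 1] by (simp_all add: numeral_2_eq_2)
  have "[trisum (Suc ?n) 0 k = (- 1) ^ Suc m * fact (Suc m) * int (Stirling k (Suc m))]
    (mod D (Suc m))" for k
  proof (cases k)
    \<comment> \<open>Here \<open>Stirling 0 (Suc m) = 0\<close>, so only divisibility is claimed,
      and residues 1 and 2 yield it.\<close>
    case 0
    have "trisum (Suc ?n) 0 0 = trisum (Suc ?n) 1 0 - trisum (Suc ?n) 2 0"
      using trisum_alternating[of "Suc ?n"] by simp
    then have "D (Suc m) dvd trisum (Suc ?n) 0 0"
      using A by (simp add: dvd_diff)
    then show ?thesis
      using 0 by (simp add: cong_0_iff)
  next
    case (Suc k')
    let ?W = "\<Sum>l\<le>k'. int (k' choose l) * trisum ?n 2 l"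
    \<comment> \<open>The factor 3 on both sides of \<open>trisum_absorb_0\<close> cancels exactly
      over the integers, so no precision is lost.\<close>
    have W: "trisum (Suc ?n) 0 k = - (int (Suc m) * ?W)"
    proof -
      have "3 * trisum (Suc ?n) 0 k = 3 * - (int (Suc m) * ?W)"
        using trisum_absorb_0[of ?n k'] unfolding Suc n[symmetric] of_nat_mult
          by (simp only: of_nat_numeral mult_minus_left mult_minus_right mult.assoc)
      then show ?thesis
        by (simp only: mult_cancel_left) simp
    qed
    have "[?W = (\<Sum>l\<le>k'. int (k' choose l) * ?S l)] (mod D m)"
      by (intro cong_sum cong_scalar_left n2)
    also have "(\<Sum>l\<le>k'. int (k' choose l) * ?S l) = (- 1) ^ m * fact m * int (Stirling k (Suc m))"
      unfolding Suc Stirling_Suc_Suc_eq_sum by (simp add: sum_distrib_left mult_ac)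
    finally have "D m dvd ?W - (- 1) ^ m * fact m * int (Stirling k (Suc m))"
      by (simp add: cong_iff_dvd_diff)
    then have "D (Suc m) dvd int (Suc m) * (?W - (- 1) ^ m * fact m * int (Stirling k (Suc m)))"
      unfolding D_def by (rule dvd_Suc_mult_fact_power)
    then have "D (Suc m) dvd - (int (Suc m) * (?W - (- 1) ^ m * fact m * int (Stirling k (Suc m))))"
      by (simp only: dvd_minus_iff)
    moreover have "- (int (Suc m) * (?W - (- 1) ^ m * fact m * int (Stirling k (Suc m))))
        = trisum (Suc ?n) 0 k - (- 1) ^ Suc m * fact (Suc m) * int (Stirling k (Suc m))"
      unfolding W fact_Suc by (simp add: algebra_simps)
    ultimately show ?thesis
      by (simp only: cong_iff_dvd_diff)
  qed
  with A show ?case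
    unfolding n by blast
qed

lemma trisum_0_mod:
  "[trisum j 0 k = (- 1) ^ (j div 3) * fact (j div 3) * int (Stirling k (j div 3))]
     (mod 3 ^ (1 + multiplicity 3 (fact (j div 3) :: nat)))"
proof -
  have "D dvd trisum (3 * (j div 3)) r l"
    if "D = 3 ^ (1 + multiplicity 3 (fact (j div 3) :: nat))" "r = 1 \<or> r = 2" for D r l
    using trisum_mod[of "j div 3"] that by blast
  then have "[trisum (3 * (j div 3) + j mod 3) 0 k = trisum (3 * (j div 3)) 0 k]
      (mod 3 ^ (1 + multiplicity 3 (fact (j div 3) :: nat)))"
    by (intro trisum_add_mod) auto
  also have "3 * (j div 3) + j mod 3 = j"
    by simp
  also note trisum_mod[of "j div 3", THEN conjunct2, rule_format, of k]
  finally show ?thesis .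
qed

subsection \<open>Binomial coefficients and Stirling numbers modulo 3\<close>

text \<open>One digit of Lucas' theorem. Three Pascal steps give \<open>(1 + x)^3 = 1 + x^3\<close>
  modulo 3 in coefficient form.\<close>

lemma binomial_mod_3:
  assumes "b < 3" "d < 3"
  shows "[(3 * a + b) choose (3 * c + d) = (a choose c) * (b choose d)] (mod 3)"
proof (induction a arbitrary: c)
  case 0
  show ?case
    using assms by (cases c) (auto simp: binomial_eq_0)
next
  case (Suc a)
  let ?n = "3 * a + b"
  have n: "3 * Suc a + b = Suc (Suc (Suc ?n))" by simp
  show ?case
  proof (cases c)
    case 0
    have "d = 0 \<or> d = Suc 0 \<or> d = Suc (Suc 0)" using assms by auto
    then have "Suc (Suc (Suc ?n)) choose d = (?n choose d) + 3 * (if d = 0 then 0 else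
      if d = Suc 0 then 1 else Suc ?n)"
      by (elim disjE) simp_all
    then have "[Suc (Suc (Suc ?n)) choose d = ?n choose d] (mod 3)"
      by (simp only: cong_def mod_mult_self2)
    also have "[?n choose d = b choose d] (mod 3)"
      using Suc.IH[of 0] by simp
    finally show ?thesis
      unfolding n by (simp add: 0)
  next
    case (Suc c')
    let ?k = "3 * c' + d"
    have "Suc (Suc (Suc ?n)) choose Suc (Suc (Suc ?k))
        = (?n choose (3 * c + d)) + (?n choose ?k) + 3 * ((?n choose Suc ?k)
          + (?n choose Suc (Suc ?k)))"
    proof -
      have "3 * c + d = Suc (Suc (Suc ?k))" by (simp add: Suc)
      then show ?thesis by (simp only: binomial_Suc_Suc) (simp del: binomial_Suc_Suc)
    qed
    moreover have "[(?n choose (3 * c + d)) + (?n choose ?k)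
      = (a choose c) * (b choose d) + (a choose c') * (b choose d)] (mod 3)"
      by (intro cong_add Suc.IH)
    ultimately have "[Suc (Suc (Suc ?n)) choose Suc (Suc (Suc ?k))
      = (a choose c) * (b choose d) + (a choose c') * (b choose d)] (mod 3)"
      by (simp only: cong_def mod_mult_self2)
    also have "(a choose c) * (b choose d) + (a choose c') * (b choose d)
      = (Suc a choose c) * (b choose d)"
      by (simp add: Suc add_mult_distrib)
    also have "Suc (Suc (Suc ?k)) = 3 * c + d"
      by (simp add: Suc)
    finally show ?thesis
      unfolding n .
  qed
qed

section \<open>The digit condition and carries in base 3\<close>

lemma T_iff: "t \<in> T \<longleftrightarrow> t mod 3 + t div 3 mod 3 < 3 \<and> t div 3 \<in> T"
proof -
  \<comment> \<open>If the upper position of a pair lies beyond the expansion, its digit is 0 and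
    the sum is at most 2.\<close>
  have T_digits: "t \<in> T \<longleftrightarrow> (\<forall>i. digit3 t i + digit3 t (Suc i) < 3)" for t
  proof -
    have "digit3 t i + digit3 t (Suc i) < 3" if "\<not> 3 ^ Suc i \<le> t" for i
      using that by (simp add: digit3_def)
    then show ?thesis
      unfolding T_def by blast
  qed
  have Suc: "digit3 t (Suc i) = digit3 (t div 3) i" for t i
    by (simp add: digit3_def div_mult2_eq)
  have all: "(\<forall>i. P i) \<longleftrightarrow> P 0 \<and> (\<forall>i. P (Suc i))" for P :: "nat \<Rightarrow> bool"
    by (metis nat.exhaust)
  show ?thesis
    unfolding T_digits by (subst all) (simp add: Suc, simp add: digit3_def)
qed

lemma zero_in_T: "0 \<in> T"
  by (simp add: T_def)

text \<open>Division by 3 shifts the digits, so adding \<open>t\<close> and \<open>t div 3\<close>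
  pairs consecutive digits of \<open>t\<close>. The induction peels off the lowest pair
  \<open>a\<close>, \<open>b\<close>.\<close>

lemma three_dvd_binomial_iff_notin_T: "3 dvd ((t + t div 3) choose t) \<longleftrightarrow> t \<notin> T"
proof (induction t rule: less_induct)
  case (less t)
  show ?case
  proof (cases "t = 0")
    case True
    then show ?thesis using zero_in_T by simp
  next
    case False
    define q where "q = t div 3"
    define a where "a = t mod 3"
    define b where "b = q mod 3"
    define q' where "q' = q div 3"
    have t: "t = 3 * q + a" "a < 3" and q: "q = 3 * q' + b" "b < 3"
      by (simp_all add: q_def a_def b_def q'_def)
    have T: "t \<in> T \<longleftrightarrow> a + b < 3 \<and> q \<in> T"
      using T_iff[of t] by (simp add: q_def a_def b_def)
    show ?thesis
    proof (cases "a + b < 3")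
      case True
      have "t + q = 3 * (q + q') + (a + b)" using t(1) q(1) by presburger
      then have "[(t + q) choose t = ((q + q') choose q) * ((a + b) choose a)] (mod 3)"
        using binomial_mod_3[OF True t(2), of "q + q'" q, folded t(1)] by (simp only:)
      then have "3 dvd ((t + q) choose t) \<longleftrightarrow> 3 dvd ((q + q') choose q) * ((a + b) choose a)"
        by (rule cong_dvd_iff)
      moreover have "\<not> 3 dvd ((a + b) choose a)"
      proof -
        have "a = 0 \<or> b = 0 \<or> a = 1 \<and> b = 1" using True by linarith
        then show ?thesis by (elim disjE conjE) (simp_all add: nat_dvd_not_less)
      qed
      moreover have "3 dvd ((q + q') choose q) \<longleftrightarrow> q \<notin> T"
        using False unfolding q'_def by (intro less.IH) (simp add: q_def)
      ultimately show ?thesis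
        using T True by (simp add: prime_dvd_mult_iff flip: q_def)
    next
      case carry: False
      \<comment> \<open>After a carry the lowest digit of the sum is \<open>a + b - 3\<close>, which
        is below \<open>a\<close>, so the Lucas factor is 0.\<close>
      have "t + q = 3 * Suc (q + q') + (a + b - 3)" using t(1) q(1) carry by presburger
      moreover have "a + b - 3 < 3" using t q by linarith
      ultimately have "[(t + q) choose t = (Suc (q + q') choose q) * ((a + b - 3) choose a)]
        (mod 3)"
        using binomial_mod_3[of "a + b - 3" a "Suc (q + q')" q, folded t(1)] t(2) by (simp only:)
      moreover have "(a + b - 3) choose a = 0"
        using q carry by (intro binomial_eq_0) linarith
      ultimately have "3 dvd ((t + q) choose t)"
        by (simp add: cong_0_iff)
      then show ?thesis
        using T carry by (simp flip: q_def)
    qed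
  qed
qed

section \<open>Columns of the Stirling triangle modulo 3\<close>

lemma Stirling_3_step:
  "[Stirling (Suc n) (3 * q + 1) = Stirling n (3 * q + 1) + Stirling n (3 * q)] (mod 3)"
  "[Stirling (Suc n) (3 * q + 2) = 2 * Stirling n (3 * q + 2) + Stirling n (3 * q + 1)] (mod 3)"
  "[Stirling (Suc n) (3 * q + 3) = Stirling n (3 * q + 2)] (mod 3)"
proof -
  have *: "Stirling (Suc n) (3 * q + Suc s) = 3 * (q * Stirling n (3 * q + Suc s))
      + (Suc s * Stirling n (3 * q + Suc s) + Stirling n (3 * q + s))" for s
    by (simp add: algebra_simps)
  have **: "[Stirling (Suc n) (3 * q + Suc s)
    = Suc s * Stirling n (3 * q + Suc s) + Stirling n (3 * q + s)] (mod 3)" for s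
    unfolding * cong_def by (rule mod_mult_self4)
  show "[Stirling (Suc n) (3 * q + 1) = Stirling n (3 * q + 1) + Stirling n (3 * q)] (mod 3)"
    using **[of 0] by simp
  show "[Stirling (Suc n) (3 * q + 2) = 2 * Stirling n (3 * q + 2) + Stirling n (3 * q + 1)]
    (mod 3)"
    using **[of 1] unfolding Suc_1 .
  have Suc_eq: "Suc 2 = 3" by simp
  have "[Stirling (Suc n) (3 * q + Suc 2)
    = 3 * Stirling n (3 * q + Suc 2) + Stirling n (3 * q + 2)] (mod 3)"
    using **[of 2] by (simp only: Suc_eq)
  also have "[3 * Stirling n (3 * q + Suc 2) + Stirling n (3 * q + 2) = Stirling n (3 * q + 2)]
    (mod 3)"
    unfolding cong_def by (rule mod_mult_self4)
  finally show "[Stirling (Suc n) (3 * q + 3) = Stirling n (3 * q + 2)] (mod 3)"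
    by (simp only: Suc_eq)
qed

text \<open>The hypotheses encode the column series \<open>x^(3q) / (1 - x^2)^q\<close>, with a sum
  in place of a difference of naturals. The next three columns arise on multiplying by
  \<open>x / (1 - x)\<close>, then by \<open>x / (1 - 2 x)\<close>, which is
  \<open>x / (1 + x)\<close> modulo 3, and finally by \<open>x\<close>.\<close>

lemma Stirling_3_block:
  assumes even: "\<And>l. [Stirling (3 * q + 2 * Suc l) (3 * q) + (q + l choose l)
    = Suc (q + l) choose Suc l] (mod 3)"
    and odd: "\<And>l. [Stirling (3 * q + 2 * l + 1) (3 * q) = 0] (mod 3)"
  shows "[Stirling (3 * q + 2 * l + 1) (3 * q + 1) = q + l choose l] (mod 3)"
    and "[Stirling (3 * q + 2 * l + 2) (3 * q + 1) = q + l choose l] (mod 3)"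
    and "[Stirling (3 * q + 2 * l + 2) (3 * q + 2) = q + l choose l] (mod 3)"
    and "[Stirling (3 * q + 2 * l + 3) (3 * q + 2) = 0] (mod 3)"
    and "[Stirling (3 * q + 2 * l + 3) (3 * q + 3) = q + l choose l] (mod 3)"
proof -
  have 1: "[Stirling (3 * q + 2 * l + 1) (3 * q + 1) = q + l choose l] (mod 3)"
    and 2: "[Stirling (3 * q + 2 * l + 2) (3 * q + 1) = q + l choose l] (mod 3)" for l
  proof (induction l)
    case 0
    show "[Stirling (3 * q + 2 * 0 + 1) (3 * q + 1) = q + 0 choose 0] (mod 3)" by simp
    then show "[Stirling (3 * q + 2 * 0 + 2) (3 * q + 1) = q + 0 choose 0] (mod 3)"
      using Stirling_3_step(1)[of "3 * q + 1" q] odd[of 0] by (simp add: cong_def mod_Suc)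
  next
    case (Suc l)
    show 1: "[Stirling (3 * q + 2 * Suc l + 1) (3 * q + 1) = q + Suc l choose Suc l] (mod 3)"
    proof -
      have "[Stirling (Suc (3 * q + 2 * l + 2)) (3 * q + 1)
          = Stirling (3 * q + 2 * l + 2) (3 * q + 1) + Stirling (3 * q + 2 * l + 2) (3 * q)]
            (mod 3)"
        by (rule Stirling_3_step)
      also have "[Stirling (3 * q + 2 * l + 2) (3 * q + 1) + Stirling (3 * q + 2 * l + 2) (3 * q)
          = (q + l choose l) + Stirling (3 * q + 2 * l + 2) (3 * q)] (mod 3)"
        by (intro cong_add Suc.IH cong_refl)
      also have "[(q + l choose l) + Stirling (3 * q + 2 * l + 2) (3 * q)
        = Suc (q + l) choose Suc l] (mod 3)"
        using even[of l] by (simp add: add.commute)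
      finally show ?thesis by simp
    qed
    show "[Stirling (3 * q + 2 * Suc l + 2) (3 * q + 1) = q + Suc l choose Suc l] (mod 3)"
    proof -
      have "[Stirling (Suc (3 * q + 2 * Suc l + 1)) (3 * q + 1)
          = Stirling (3 * q + 2 * Suc l + 1) (3 * q + 1) + Stirling (3 * q + 2 * Suc l
            + 1) (3 * q)] (mod 3)"
        by (rule Stirling_3_step)
      also have "[Stirling (3 * q + 2 * Suc l + 1) (3 * q + 1) + Stirling (3 * q + 2 * Suc l
        + 1) (3 * q)
          = (q + Suc l choose Suc l) + 0] (mod 3)"
        by (intro cong_add 1 odd)
      finally show ?thesis by simp
    qed
  qed
  \<comment> \<open>Conditional on the preceding entry of the column, so that the induction for that
    entry can use it; the cancellation is \<open>2 c + c = 3 c\<close>.\<close>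
  have 4: "[Stirling (3 * q + 2 * l + 3) (3 * q + 2) = 0] (mod 3)"
    if "[Stirling (3 * q + 2 * l + 2) (3 * q + 2) = q + l choose l] (mod 3)" for l
  proof -
    have "[Stirling (Suc (3 * q + 2 * l + 2)) (3 * q + 2)
        = 2 * Stirling (3 * q + 2 * l + 2) (3 * q + 2) + Stirling (3 * q + 2 * l + 2) (3 * q + 1)]
          (mod 3)"
      by (rule Stirling_3_step)
    also have "[2 * Stirling (3 * q + 2 * l + 2) (3 * q + 2) + Stirling (3 * q + 2 * l + 2) (3 * q
      + 1)
        = 2 * (q + l choose l) + (q + l choose l)] (mod 3)"
      by (intro cong_add cong_mult cong_refl that 2)
    also have "[2 * (q + l choose l) + (q + l choose l) = 0] (mod 3)"
      by (simp add: cong_0_iff)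
    finally show ?thesis by (simp add: eval_nat_numeral)
  qed
  have 3: "[Stirling (3 * q + 2 * l + 2) (3 * q + 2) = q + l choose l] (mod 3)" for l
  proof (induction l)
    case 0
    show ?case by simp
  next
    case (Suc l)
    have "[Stirling (Suc (3 * q + 2 * l + 3)) (3 * q + 2)
        = 2 * Stirling (3 * q + 2 * l + 3) (3 * q + 2) + Stirling (3 * q + 2 * l + 3) (3 * q + 1)]
          (mod 3)"
      by (rule Stirling_3_step)
    also have "[2 * Stirling (3 * q + 2 * l + 3) (3 * q + 2) + Stirling (3 * q + 2 * l + 3) (3 * q
      + 1)
        = 2 * 0 + (q + Suc l choose Suc l)] (mod 3)"
      using 1[of "Suc l"] by (intro cong_add cong_mult cong_refl 4 Suc.IH) (simp add: eval_nat_numeral)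
    finally show ?case by (simp add: eval_nat_numeral)
  qed
  have "[Stirling (Suc (3 * q + 2 * l + 2)) (3 * q + 3) = q + l choose l] (mod 3)"
    by (rule cong_trans[OF Stirling_3_step(3) 3])
  then show "[Stirling (3 * q + 2 * l + 3) (3 * q + 3) = q + l choose l] (mod 3)"
    by (simp add: eval_nat_numeral)
  show "[Stirling (3 * q + 2 * l + 1) (3 * q + 1) = q + l choose l] (mod 3)"
    "[Stirling (3 * q + 2 * l + 2) (3 * q + 1) = q + l choose l] (mod 3)"
    "[Stirling (3 * q + 2 * l + 2) (3 * q + 2) = q + l choose l] (mod 3)"
    "[Stirling (3 * q + 2 * l + 3) (3 * q + 2) = 0] (mod 3)"
    by (fact 1 2 3 4[OF 3])+
qed

text \<open>Column \<open>3 * q + 3\<close> of one block is the input column of the next; Pascal's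
  rule restores the additive form.\<close>

lemma Stirling_multiple_of_3:
  "(\<forall>l. [Stirling (3 * q + 2 * Suc l) (3 * q) + (q + l choose l) = Suc (q + l) choose Suc l]
    (mod 3)) \<and>
   (\<forall>l. [Stirling (3 * q + 2 * l + 1) (3 * q) = 0] (mod 3))"
proof (induction q)
  case 0
  show ?case by simp
next
  case (Suc q)
  note block = Stirling_3_block[OF Suc.IH[THEN conjunct1, rule_format] Suc.IH[THEN conjunct2, rule_format]]
  show ?case
  proof (intro conjI allI)
    fix l
    have "[Stirling (3 * q + 2 * Suc l + 3) (3 * q + 3) + (Suc q + l choose l)
      = (q + Suc l choose Suc l) + (Suc q + l choose l)] (mod 3)"
      by (intro cong_add block cong_refl)
    moreover have "3 * q + 2 * Suc l + 3 = 3 * Suc q + 2 * Suc l" "3 * q + 3 = 3 * Suc q"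
      "(q + Suc l choose Suc l) + (Suc q + l choose l) = Suc (Suc q + l) choose Suc l"
      by simp_all
    ultimately show "[Stirling (3 * Suc q + 2 * Suc l) (3 * Suc q) + (Suc q + l choose l)
      = Suc (Suc q + l) choose Suc l] (mod 3)"
      by (simp only:)
    have "[Stirling (Suc (3 * q + 2 * l + 3)) (3 * q + 3) = 0] (mod 3)"
      by (rule cong_trans[OF Stirling_3_step(3) block(4)])
    moreover have "Suc (3 * q + 2 * l + 3) = 3 * Suc q + 2 * l + 1" "3 * q + 3 = 3 * Suc q"
      by simp_all
    ultimately show "[Stirling (3 * Suc q + 2 * l + 1) (3 * Suc q) = 0] (mod 3)"
      by (simp only:)
  qed
qed

text \<open>Facts 1 and 2 concern column \<open>3 * q\<close>, 3 and 4 column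
  \<open>3 * q + 1\<close>, 5 and 6 column \<open>3 * q + 2\<close>, and 7 column
  \<open>3 * q + 3\<close>.\<close>

lemmas Stirling_mod_3 =
  Stirling_multiple_of_3[THEN conjunct1, rule_format]
  Stirling_multiple_of_3[THEN conjunct2, rule_format]
  Stirling_3_block[OF Stirling_multiple_of_3[THEN conjunct1, rule_format]
    Stirling_multiple_of_3[THEN conjunct2, rule_format]]

subsection \<open>Valuations and the digit condition\<close>

lemma enat_le_nu3_iff: "enat e \<le> nu3 m \<longleftrightarrow> 3 ^ e dvd m"
  by (auto simp: nu3_def power_dvd_iff_le_multiplicity)

lemma enat_le_e3_iff: "enat e \<le> e3 k n \<longleftrightarrow> (\<forall>j\<ge>n. 3 ^ e dvd a3 k j)"
  by (auto simp: e3_def le_INF_iff enat_le_nu3_iff)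

lemma enat_eq_iff_le_Suc: "x = enat s \<longleftrightarrow> enat s \<le> x \<and> \<not> enat (Suc s) \<le> x"
  by (cases x) auto

lemma multiplicity_fact_mono:
  "m \<le> n \<Longrightarrow> multiplicity p (fact m :: nat) \<le> multiplicity p (fact n :: nat)"
  by (intro dvd_imp_multiplicity_le fact_dvd) auto

lemma multiplicity_3_fact_eq_iff:
  assumes "m \<le> n"
  shows "multiplicity 3 (fact n :: nat) = multiplicity 3 (fact m :: nat) \<longleftrightarrow> n div 3 = m div 3"
proof
  have "multiplicity 3 (fact (3 * q + s) :: nat) = multiplicity 3 (fact (3 * q) :: nat)"
    if "s < 3" for q s
    using that
  proof (induction s)
    case (Suc s)
    then have "\<not> 3 dvd Suc (3 * q + s)"
      by presburger
    then show ?case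
      using Suc by (simp add: multiplicity_3_fact_Suc not_dvd_imp_multiplicity_0 del: fact_Suc)
  qed simp
  then have "multiplicity 3 (fact i :: nat) = multiplicity 3 (fact (3 * (i div 3)) :: nat)" for i
    by (metis mult_div_mod_eq mod_less_divisor zero_less_numeral)
  then show "n div 3 = m div 3 \<Longrightarrow> multiplicity 3 (fact n :: nat) = multiplicity 3 (fact m :: nat)"
    by metis
next
  assume eq: "multiplicity 3 (fact n :: nat) = multiplicity 3 (fact m :: nat)"
  show "n div 3 = m div 3"
  proof (rule ccontr)
    assume "n div 3 \<noteq> m div 3"
    \<comment> \<open>\<open>Suc i\<close> is the first multiple of 3 above \<open>m\<close>; it is
      at most \<open>n\<close>, so the exponent jumps in between.\<close>
    define i where "i = 3 * (m div 3) + 2"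
    have i: "Suc i = 3 * Suc (m div 3)" by (simp add: i_def)
    have "m \<le> i" "Suc i \<le> n"
      using assms \<open>n div 3 \<noteq> m div 3\<close> div_le_mono[OF assms, of 3] unfolding i_def by linarith+
    have "multiplicity 3 (Suc i) > 0"
      unfolding i by (subst multiplicity_gt_zero_iff) auto
    then have "multiplicity 3 (fact i :: nat) < multiplicity 3 (fact (Suc i) :: nat)"
      unfolding multiplicity_3_fact_Suc by simp
    then show False
      using eq multiplicity_fact_mono[OF \<open>m \<le> i\<close>, of 3] multiplicity_fact_mono[OF \<open>Suc i \<le> n\<close>, of 3]
      by linarith
  qed
qed

section \<open>From valuations to Stirling numbers\<close>

text \<open>\<open>s3 n\<close> is always a lower bound: \<open>n - 1\<close> comes from the
  extracted power of 3, the rest from the factorial. It is attained at \<open>j\<close> exactly if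
  the factorial of \<open>j div 3\<close> contributes no further 3 and the Stirling number
  contributes none.\<close>

lemma e3_eq_s3_iff_Stirling:
  assumes "n \<ge> 1"
  shows "e3 (n - 1) n = enat (s3 n) \<longleftrightarrow>
    (\<exists>m\<ge>n div 3. m div 3 = n div 9 \<and> \<not> 3 dvd Stirling (n - 1) m)"
proof -
  define v where "v m = multiplicity 3 (fact m :: nat)" for m
  let ?m = "n div 3"
  \<comment> \<open>The bound on \<open>e\<close> is the precision of \<open>trisum_0_mod\<close>.
    The exponent \<open>v ?m\<close> yields the lower bound, and \<open>Suc (v ?m)\<close> tests for
    equality.\<close>
  have a3: "3 ^ (n - 1 + e) dvd a3 (n - 1) j
    \<longleftrightarrow> 3 ^ e dvd fact (j div 3) * Stirling (n - 1) (j div 3)"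
    if "j \<ge> n" "e \<le> 1 + v (j div 3)" for e j
  proof -
    have "3 ^ (n - 1 + e) dvd a3 (n - 1) j \<longleftrightarrow> 3 ^ e dvd trisum j 0 (n - 1)"
    proof -
      have "n - 1 < j" using assms that by simp
      then show ?thesis
        unfolding a3_eq_trisum[OF \<open>n - 1 < j\<close>] power_add mult_minus_left dvd_minus_iff by simp
    qed
    also have "\<dots> \<longleftrightarrow> 3 ^ e dvd (- 1) ^ (j div 3) * fact (j div 3) * int (Stirling (n - 1) (j div 3))"
      using that(2) unfolding v_def
        by (intro cong_dvd_iff cong_dvd_modulus[OF trisum_0_mod] le_imp_power_dvd)
    also have "\<dots> \<longleftrightarrow> 3 ^ e dvd int (fact (j div 3) * Stirling (n - 1) (j div 3))"
      by (simp add: minus_one_power_iff)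
    also have "\<dots> \<longleftrightarrow> 3 ^ e dvd fact (j div 3) * Stirling (n - 1) (j div 3)"
      using of_nat_dvd_iff[of "3 ^ e" "fact (j div 3) * Stirling (n - 1) (j div 3)", where 'a = int]
      by (simp only: of_nat_power of_nat_numeral)
    finally show ?thesis .
  qed
  have v_le: "v ?m \<le> v (j div 3)" if "j \<ge> n" for j
    unfolding v_def using that by (intro multiplicity_fact_mono div_le_mono)
  have dvd_fact: "3 ^ v m dvd (fact m :: nat)" for m
    unfolding v_def by (rule multiplicity_dvd)
  have ge: "enat (s3 n) \<le> e3 (n - 1) n"
    unfolding enat_le_e3_iff s3_def v_def[symmetric]
  proof (intro allI impI)
    fix j assume j: "n \<le> j"
    have "3 ^ v ?m dvd (fact (j div 3) :: nat)"
      using v_le[OF j] dvd_fact[of "j div 3"] by (rule dvd_trans[OF le_imp_power_dvd])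
    then show "3 ^ (n - 1 + v ?m) dvd a3 (n - 1) j"
      using a3[of j "v ?m"] v_le[OF j] j by simp
  qed
  have "3 ^ Suc (v ?m) dvd fact (j div 3) * Stirling (n - 1) (j div 3)
      \<longleftrightarrow> v (j div 3) \<noteq> v ?m \<or> 3 dvd Stirling (n - 1) (j div 3)" if "j \<ge> n" for j
  \<comment> \<open>Zero is divisible by every power of 3, but its \<open>multiplicity\<close> is 0,
    so it is treated apart.\<close>
  proof (cases "Stirling (n - 1) (j div 3) = 0")
    case False
    then have "multiplicity 3 (fact (j div 3) * Stirling (n - 1) (j div 3))
        = v (j div 3) + multiplicity 3 (Stirling (n - 1) (j div 3))"
      by (simp add: v_def prime_elem_multiplicity_mult_distrib)
    moreover have "3 dvd Stirling (n - 1) (j div 3)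
      \<longleftrightarrow> multiplicity 3 (Stirling (n - 1) (j div 3)) > 0"
      using False by (simp add: multiplicity_gt_zero_iff)
    moreover have "3 ^ Suc (v ?m) dvd fact (j div 3) * Stirling (n - 1) (j div 3)
        \<longleftrightarrow> Suc (v ?m) \<le> multiplicity 3 (fact (j div 3) * Stirling (n - 1) (j div 3))"
      using False by (intro power_dvd_iff_le_multiplicity) auto
    ultimately show ?thesis
      using v_le[OF that] by linarith
  qed simp
  then have "3 ^ Suc (s3 n) dvd a3 (n - 1) j
      \<longleftrightarrow> v (j div 3) \<noteq> v ?m \<or> 3 dvd Stirling (n - 1) (j div 3)" if "j \<ge> n" for j
    using a3[of j "Suc (v ?m)"] v_le that by (simp add: s3_def v_def[symmetric] del: power_Suc)
  then have "e3 (n - 1) n = enat (s3 n) \<longleftrightarrow>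
      (\<exists>j\<ge>n. v (j div 3) = v ?m \<and> \<not> 3 dvd Stirling (n - 1) (j div 3))"
    unfolding enat_eq_iff_le_Suc[of "e3 (n - 1) n"] using ge enat_le_e3_iff[of "Suc (s3 n)"]
      by blast
  also have "\<dots> \<longleftrightarrow> (\<exists>m\<ge>?m. v m = v ?m \<and> \<not> 3 dvd Stirling (n - 1) m)"
  proof -
    \<comment> \<open>For \<open>m = ?m\<close> the witness is \<open>n\<close> itself, since
      \<open>3 * m\<close> may lie below \<open>n\<close>.\<close>
    have "\<exists>j\<ge>n. j div 3 = m" if "m \<ge> ?m" for m
    proof (cases "m = ?m")
      case False
      with that show ?thesis by (intro exI[of _ "3 * m"]) auto
    qed auto
    then show ?thesis
      using div_le_mono by metis
  qed
  also have "\<dots> \<longleftrightarrow> (\<exists>m\<ge>?m. m div 3 = n div 9 \<and> \<not> 3 dvd Stirling (n - 1) m)"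
  proof -
    have "n div 3 div 3 = n div 9" by (simp add: div_mult2_eq[symmetric])
    then show ?thesis
      using multiplicity_3_fact_eq_iff[of ?m] unfolding v_def by metis
  qed
  finally show ?thesis .
qed

section \<open>Case analysis modulo 9\<close>

text \<open>The candidates are \<open>m = 3 * q + s\<close> with \<open>a <= s < 3\<close>. The
  parity of \<open>n - 1 - 3 * q\<close> decides which columns can survive. The relevant
  \<open>l\<close> is either \<open>3 * q + c\<close> with \<open>c < 3\<close>, so that
  \<open>l div 3 = q\<close>, or \<open>3 * q - 1\<close>, where \<open>Tpred\<close>
  applies.\<close>

lemma ex_Stirling_not_dvd_3_iff:
  assumes "n \<ge> 1" and n: "n = 9 * q + 3 * a + b" "a < 3" "b < 3"
  shows "(\<exists>m\<ge>n div 3. m div 3 = n div 9 \<and> \<not> 3 dvd Stirling (n - 1) m) \<longleftrightarrow>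
    (a, b) \<in> {(0, 1), (0, 2), (1, 1), (1, 2), (2, 1)} \<and> 3 * q + a \<in> T \<or> (a, b) = (1, 0) \<and> q \<in> T"
proof -
  define P where "P s \<longleftrightarrow> \<not> 3 dvd Stirling (n - 1) (3 * q + s)" for s
  have div: "n div 3 = 3 * q + a" "n div 9 = q"
    using n by presburger+
  have "(\<exists>m\<ge>n div 3. m div 3 = n div 9 \<and> \<not> 3 dvd Stirling (n - 1) m) \<longleftrightarrow>
      (\<exists>m. (\<exists>s. m = 3 * q + s \<and> a \<le> s \<and> s < 3) \<and> \<not> 3 dvd Stirling (n - 1) m)"
  proof (intro ex_cong1)
    fix m
    have "3 * q + a \<le> m \<and> m div 3 = q \<longleftrightarrow> (\<exists>s. m = 3 * q + s \<and> a \<le> s \<and> s < 3)"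
      (is "?L \<longleftrightarrow> ?R")
    proof
      assume ?L
      then have "m = 3 * q + m mod 3 \<and> a \<le> m mod 3 \<and> m mod 3 < 3" by presburger
      then show ?R by blast
    qed auto
    then show "(n div 3 \<le> m \<and> m div 3 = n div 9 \<and> \<not> 3 dvd Stirling (n - 1) m) \<longleftrightarrow>
        (\<exists>s. m = 3 * q + s \<and> a \<le> s \<and> s < 3) \<and> \<not> 3 dvd Stirling (n - 1) m"
      unfolding div by blast
  qed
  also have "\<dots> \<longleftrightarrow> (\<exists>s. a \<le> s \<and> s < 3 \<and> P s)"
    unfolding P_def by blast
  also have "\<dots> \<longleftrightarrow> a = 0 \<and> P 0 \<or> a \<le> 1 \<and> P 1 \<or> P 2"
  proof -
    have "(\<exists>s. a \<le> s \<and> s < 3 \<and> P s) \<longleftrightarrow> (\<exists>s\<in>{..<3}. a \<le> s \<and> P s)"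
      by blast
    also have "{..<3} = {0, 1, 2 :: nat}"
      by auto
    finally have "(\<exists>s. a \<le> s \<and> s < 3 \<and> P s) \<longleftrightarrow> a \<le> 0 \<and> P 0 \<or> a \<le> 1 \<and> P 1 \<or> a \<le> 2 \<and> P 2"
      by simp
    moreover have "a \<le> 2" using n(2) by simp
    ultimately show ?thesis by (simp only: le_zero_eq simp_thms)
  qed
  finally have ex: "(\<exists>m\<ge>n div 3. m div 3 = n div 9 \<and> \<not> 3 dvd Stirling (n - 1) m)
      \<longleftrightarrow> a = 0 \<and> P 0 \<or> a \<le> 1 \<and> P 1 \<or> P 2" .
  have T: "\<not> 3 dvd (q + (3 * q + c) choose (3 * q + c)) \<longleftrightarrow> 3 * q + c \<in> T" if "c < 3" for c
    using three_dvd_binomial_iff_notin_T[of "3 * q + c"] that by (simp add: add.commute)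
  have T3: "q \<in> T \<longleftrightarrow> 3 * q \<in> T"
    using T_iff[of "3 * q"] by simp
  \<comment> \<open>Absorption for the coefficient of \<open>4 * q\<close> over
    \<open>3 * q\<close>, divided by \<open>q\<close>, leaves a factor 3 against a factor 4.\<close>
  have Tpred: "3 dvd (q + (3 * q - 1) choose (3 * q - 1))" if q: "q > 0"
  proof -
    obtain l where l: "3 * q = Suc l" using q not0_implies_Suc[of "3 * q"] by auto
    have "Suc l * (Suc (q + l) choose Suc l) = Suc (q + l) * (q + l choose l)"
      by (rule Suc_times_binomial)
    moreover have "Suc (q + l) = 4 * q"
      using l by simp
    ultimately have "3 * q * (4 * q choose Suc l) = 4 * q * (q + l choose l)"
      by (simp only: l)
    then have "3 * (4 * q choose Suc l) = 4 * (q + l choose l)"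
      using q by simp
    then have "3 dvd (q + l choose l)"
      by presburger
    then show ?thesis by (simp add: l)
  qed
  have s0_odd: "\<not> P 0" if "n = 3 * q + 2 * l + 2" for l
  proof -
    have "n - 1 = 3 * q + 2 * l + 1" using that by simp
    then show ?thesis
      using cong_dvd_iff[OF Stirling_mod_3(2)[of q l]]
        by (simp only: P_def add_0_right dvd_0_right simp_thms)
  qed
  have s1: "P 1 \<longleftrightarrow> \<not> 3 dvd (q + l choose l)" if "n = 3 * q + 2 * l + 2 \<or> n = 3 * q + 2 * l + 3" for l
  proof -
    have "n - 1 = 3 * q + 2 * l + 1 \<or> n - 1 = 3 * q + 2 * l + 2" using that by auto
    then show ?thesis
      using cong_dvd_iff[OF Stirling_mod_3(3)[of q l]] cong_dvd_iff[OF Stirling_mod_3(4)[of q l]]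
      by (elim disjE) (simp_all only: P_def)
  qed
  have s2: "P 2 \<longleftrightarrow> \<not> 3 dvd (q + l choose l)" if "n = 3 * q + 2 * l + 3" for l
  proof -
    have "n - 1 = 3 * q + 2 * l + 2" using that by simp
    then show ?thesis
      using cong_dvd_iff[OF Stirling_mod_3(5)[of q l]] by (simp only: P_def)
  qed
  have s2_odd: "\<not> P 2" if "n = 3 * q + 2 * l + 4" for l
  proof -
    have "n - 1 = 3 * q + 2 * l + 3" using that by simp
    then show ?thesis
      using cong_dvd_iff[OF Stirling_mod_3(6)[of q l]] by (simp only: P_def dvd_0_right simp_thms)
  qed
  \<comment> \<open>\<open>s1\<close> and \<open>s2\<close> start only at
    \<open>n = 3 * q + 2\<close> and \<open>n = 3 * q + 3\<close>.\<close>
  have small: "\<not> P 1" "\<not> P 2" if "n = 1" "q = 0"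
    using that by (simp_all add: P_def)
  have "a = 0 \<or> a = 1 \<or> a = 2" "b = 0 \<or> b = 1 \<or> b = 2"
    using n by linarith+
  then consider "a = 0" "b = 0" | "a = 0" "b = 1" | "a = 0" "b = 2" | "a = 1" "b = 0" | "a = 1" "b
    = 1"
    | "a = 1" "b = 2" | "a = 2" "b = 0" | "a = 2" "b = 1" | "a = 2" "b = 2"
    by (elim disjE) simp_all
  then show ?thesis
  proof cases
    case 1
    then have "q > 0" using assms by simp
    then have "n = 3 * q + 2 * (3 * q - 1) + 2" "n = 3 * q + 2 * (3 * q - 2) + 4"
      using n 1 by presburger+
    then have "\<not> P 0" "\<not> P 1" "\<not> P 2"
      using s0_odd s1 s2_odd Tpred[OF \<open>q > 0\<close>] by blast+
    then show ?thesis unfolding ex using 1 by simp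
  next
    case 2
    have "\<not> P 1 \<and> \<not> P 2"
    proof (cases "q = 0")
      case True
      then show ?thesis using small n 2 by simp
    next
      case False
      then have "q > 0" "n = 3 * q + 2 * (3 * q - 1) + 3"
        using n 2 by presburger+
      then show ?thesis using s1 s2 Tpred by blast
    qed
    \<comment> \<open>With \<open>l = 3 * q - 1\<close>, the added term in
      \<open>Stirling_mod_3(1)\<close> is divisible by 3, so the Stirling number agrees modulo 3
      with the coefficient of \<open>4 * q\<close> over \<open>3 * q\<close>.\<close>
    moreover have "P 0 \<longleftrightarrow> 3 * q \<in> T"
    proof (cases "q = 0")
      case True
      then show ?thesis using n 2 zero_in_T by (simp add: P_def)
    next
      case False
      then obtain l where l: "3 * q = Suc l" using not0_implies_Suc[of "3 * q"] by auto
      have "3 dvd (q + l choose l)" using Tpred False l by simp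
      moreover have "3 * q + 2 * Suc l = n - 1" using l n 2 by simp
      ultimately have "3 dvd Stirling (n - 1) (3 * q) \<longleftrightarrow> 3 dvd (q + 3 * q choose (3 * q))"
        using cong_dvd_iff[OF Stirling_mod_3(1)[of q l]]
          by (simp add: l dvd_add_left_iff del: binomial_Suc_Suc)
      then show ?thesis using T[of 0] by (simp add: P_def)
    qed
    ultimately show ?thesis unfolding ex using 2 by simp
  next
    case 3
    have "\<not> P 2"
    proof (cases "q = 0")
      case True
      then show ?thesis using n 3 by (simp add: P_def)
    next
      case False
      then have "n = 3 * q + 2 * (3 * q - 1) + 4"
        using n 3 by presburger
      then show ?thesis by (rule s2_odd)
    qed
    then show ?thesis
      unfolding ex using s0_odd[of "3 * q"] s1[of "3 * q"] T[of 0] n 3 by simp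
  next
    \<comment> \<open>Here \<open>l = 3 * q\<close> although \<open>n div 3 = 3 * q + 1\<close>, so
      the condition falls on \<open>q\<close>; this is the source of \<open>9 T + 3\<close>.\<close>
    case 4
    then show ?thesis unfolding ex using s1[of "3 * q"] s2[of "3 * q"] T[of 0] T3 n by simp
  next
    case 5
    then show ?thesis unfolding ex using s1[of "3 * q + 1"] s2_odd[of "3 * q"] T[of 1] n by simp
  next
    case 6
    then show ?thesis unfolding ex using s1[of "3 * q + 1"] s2[of "3 * q + 1"] T[of 1] n by simp
  next
    case 7
    then show ?thesis unfolding ex using s2_odd[of "3 * q + 1"] n by simp
  next
    case 8
    then show ?thesis unfolding ex using s2[of "3 * q + 2"] T[of 2] n by simp
  next
    case 9
    then show ?thesis unfolding ex using s2_odd[of "3 * q + 2"] n by simp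
  qed
qed

theorem theorem1p9:
  fixes n :: nat
  assumes "n \<ge> 1"
  shows "e3 (n - 1) n = enat (s3 n) \<longleftrightarrow>
    n \<in> (\<lambda>t. 3 * t + 1) ` T \<union> (\<lambda>t. 3 * t + 2) ` T' \<union> (\<lambda>t. 9 * t + 3) ` T"
proof -
  \<comment> \<open>As \<open>n div 3 = 3 * q + a\<close>, the pairs with \<open>b = 1\<close> give
    \<open>3 T + 1\<close>, those with \<open>b = 2\<close> and \<open>a\<close> not 2 give
    \<open>3 T' + 2\<close>, and \<open>(1, 0)\<close> gives \<open>9 T + 3\<close>.\<close>
  define q where "q = n div 3 div 3"
  define a where "a = n div 3 mod 3"
  define b where "b = n mod 3"
  have ab: "a < 3" "b < 3" by (simp_all add: a_def b_def)
  have n3: "n = 3 * (n div 3) + b" "n div 3 = 3 * q + a"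
    by (simp_all add: q_def a_def b_def)
  then have n: "n = 9 * q + 3 * a + b" by linarith
  have 1: "n \<in> (\<lambda>t. 3 * t + 1) ` T \<longleftrightarrow> b = 1 \<and> 3 * q + a \<in> T"
  proof -
    have "n = 3 * t + 1 \<longleftrightarrow> b = 1 \<and> t = n div 3" for t
      unfolding b_def by presburger
    then show ?thesis unfolding image_iff using n3 by auto
  qed
  have 2: "n \<in> (\<lambda>t. 3 * t + 2) ` T' \<longleftrightarrow> b = 2 \<and> a \<noteq> 2 \<and> 3 * q + a \<in> T"
  proof -
    have "n = 3 * t + 2 \<longleftrightarrow> b = 2 \<and> t = n div 3" for t
      unfolding b_def by presburger
    then have "n \<in> (\<lambda>t. 3 * t + 2) ` T' \<longleftrightarrow> b = 2 \<and> n div 3 \<in> T'"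
      unfolding image_iff by auto
    also have "n div 3 \<in> T' \<longleftrightarrow> 3 * q + a \<in> T \<and> a \<noteq> 2"
      unfolding n3(2)[symmetric] by (simp add: T'_def a_def)
    finally show ?thesis by blast
  qed
  have 3: "n \<in> (\<lambda>t. 9 * t + 3) ` T \<longleftrightarrow> a = 1 \<and> b = 0 \<and> q \<in> T"
  proof -
    have "n = 9 * t + 3 \<longleftrightarrow> a = 1 \<and> b = 0 \<and> t = q" for t
    proof
      assume "n = 9 * t + 3"
      then have "n = 3 * (3 * t + 1)" by simp
      then show "a = 1 \<and> b = 0 \<and> t = q" by (simp add: a_def b_def q_def)
    qed (simp add: n)
    then show ?thesis unfolding image_iff by auto
  qed
  have "a = 0 \<or> a = 1 \<or> a = 2" "b = 0 \<or> b = 1 \<or> b = 2"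
    using ab by linarith+
  then show ?thesis
    unfolding e3_eq_s3_iff_Stirling[OF assms] ex_Stirling_not_dvd_3_iff[OF assms n ab] Un_iff 1 2 3
    by auto
qed

end
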